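(* There are infinitely many (pairwise non-isomorphic) finite simple biconnected outerplanar graphs $G$ with maximum degree $\Delta = 5$ such that $\chi(G^2) = 7$.
   Context: $G^2$ is the graph on $V(G)$ in which two distinct vertices are adjacent iff their distance in $G$ is 1 or 2; $\chi$ is the chromatic number. *)

theory Defs
  imports "HOL-Analysis.Analysis" "Graph_Theory.Graph_Theory"
begin

text \<open>
  A finite simple graph is a \<open>pair_graph\<close>: a finite, loop-free, symmetric set of pairs of
  vertices. Every undirected edge \<open>{u, v}\<close> is thus present as the two arcs \<open>(u, v)\<close> and
  \<open>(v, u)\<close>, so the degree of a vertex is its out-degree.
\<close>

definition max_degree :: "'a pair_pre_digraph \<Rightarrow> nat" where
  "max_degree G = Max (out_degree (with_proj G) ` pverts G)"

definition biconnected :: "'a pair_pre_digraph \<Rightarrow> bool" where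
  "biconnected G \<longleftrightarrow>
     card (pverts G) \<ge> 3 \<and>
     Digraph_Component.connected (with_proj G) \<and>
     (\<forall>v\<in>pverts G. Digraph_Component.connected (pre_digraph.del_vert (with_proj G) v))"

definition graph_dist :: "'a pair_pre_digraph \<Rightarrow> 'a \<Rightarrow> 'a \<Rightarrow> ereal" where
  "graph_dist G u v = wf_digraph.\<mu> (with_proj G) (\<lambda>_. 1) u v"

definition graph_square :: "'a pair_pre_digraph \<Rightarrow> 'a pair_pre_digraph" where
  "graph_square G =
     \<lparr> pverts = pverts G,
       parcs = {(u, v). u \<in> pverts G \<and> v \<in> pverts G \<and> u \<noteq> v \<and>
                        (graph_dist G u v = 1 \<or> graph_dist G u v = 2)} \<rparr>"

definition proper_colouring :: "'a pair_pre_digraph \<Rightarrow> nat \<Rightarrow> ('a \<Rightarrow> nat) \<Rightarrow> bool" where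
  "proper_colouring G k c \<longleftrightarrow>
     (\<forall>v\<in>pverts G. c v < k) \<and> (\<forall>(u, v)\<in>parcs G. c u \<noteq> c v)"

definition chromatic_number :: "'a pair_pre_digraph \<Rightarrow> nat" where
  "chromatic_number G = (LEAST k. \<exists>c. proper_colouring G k c)"

definition undirected_edges :: "'a pair_pre_digraph \<Rightarrow> 'a set set" where
  "undirected_edges G = {{u, v} |u v. (u, v) \<in> parcs G}"

text \<open>
  A crossing-free drawing in the plane: \<open>p\<close> places the vertices, and \<open>\<gamma> e\<close> is a simple curve
  joining the two ends of the undirected edge \<open>e\<close> (in either orientation). Note that \<open>arc\<close>
  is here the topological notion, not the one of digraphs.
\<close>

definition plane_drawing ::
    "'a pair_pre_digraph \<Rightarrow> ('a \<Rightarrow> complex) \<Rightarrow> ('a set \<Rightarrow> real \<Rightarrow> complex) \<Rightarrow> bool" where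
  "plane_drawing G p \<gamma> \<longleftrightarrow>
     inj_on p (pverts G) \<and>
     (\<forall>e\<in>undirected_edges G.
        Path_Connected.arc (\<gamma> e) \<and>
        {pathstart (\<gamma> e), pathfinish (\<gamma> e)} = p ` e \<and>
        path_image (\<gamma> e) \<inter> p ` pverts G = p ` e) \<and>
     (\<forall>e\<in>undirected_edges G. \<forall>f\<in>undirected_edges G. e \<noteq> f \<longrightarrow>
        path_image (\<gamma> e) \<inter> path_image (\<gamma> f) = p ` (e \<inter> f))"

definition drawing_image ::
    "'a pair_pre_digraph \<Rightarrow> ('a \<Rightarrow> complex) \<Rightarrow> ('a set \<Rightarrow> real \<Rightarrow> complex) \<Rightarrow> complex set" where
  "drawing_image G p \<gamma> = p ` pverts G \<union> (\<Union>e\<in>undirected_edges G. path_image (\<gamma> e))"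

text \<open>
  The image of a drawing of a finite graph is bounded, so \<open>outside\<close> of it is its unique
  unbounded face; outerplanarity asks for all vertices to lie on the boundary of that face.
\<close>

definition outerplanar :: "'a pair_pre_digraph \<Rightarrow> bool" where
  "outerplanar G \<longleftrightarrow>
     (\<exists>p \<gamma>. plane_drawing G p \<gamma> \<and> p ` pverts G \<subseteq> frontier (outside (drawing_image G p \<gamma>)))"

end

theory Submission
  imports Defs
begin

text \<open>
  The graphs are cycles \<open>0, \<dots>, n - 1\<close> with the six chords \<open>0-9, 1-3, 1-7, 3-5, 3-7, 7-9\<close>. No two
  chords cross, so placing vertex \<open>k\<close> at the point \<open>(k, k\<^sup>2)\<close> of a parabola and drawing the edges as
  straight segments gives an outerplanar drawing: everything lies in the convex epigraph, below
  which the plane is open to infinity.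

  Suppose that the square had a proper colouring \<open>c\<close> with six colours. The closed neighbourhood
  \<open>{1, 3, 6, 7, 8, 9}\<close> of \<open>7\<close> uses all of them, and \<open>0\<close> is within distance two of each of these
  vertices except \<open>6\<close>, so \<open>c 0 = c 6\<close>. The closed neighbourhood \<open>{1, 2, 3, 4, 5, 7}\<close> of \<open>3\<close> uses all
  six colours as well; but \<open>6\<close> is within distance two of all of its vertices except \<open>2\<close>, while \<open>2\<close>
  is within distance two of \<open>0\<close>. So no vertex of that neighbourhood can have the colour
  \<open>c 6 = c 0\<close>, a contradiction. Seven colours suffice if \<open>n\<close> is one more than a multiple of three,
  the long path from \<open>9\<close> back to \<open>0\<close> being coloured periodically with three colours.
\<close>

section \<open>Distances and squares in terms of walks\<close>

text \<open>Unit weights make the cost of a walk its length, and an infimum of natural numbers is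
  attained unless there is no walk at all, when it is infinite.\<close>

lemma (in pair_wf_digraph) graph_dist_eq_iff:
  "graph_dist G u v = ereal (real n) \<longleftrightarrow>
     (\<exists>p. awalk u p v \<and> length p = n) \<and> (\<forall>p. awalk u p v \<longrightarrow> n \<le> length p)"
proof -
  have cost: "awalk_cost (\<lambda>_. 1) p = real (length p)" for p :: "('a \<times> 'a) list"
    by (induction p) auto
  have dist: "graph_dist G u v = (INF p\<in>{p. awalk u p v}. ereal (real (length p)))"
    unfolding graph_dist_def \<mu>_def cost ..
  have ge: "ereal (real m) \<le> graph_dist G u v" if "\<forall>p. awalk u p v \<longrightarrow> m \<le> length p" for m
    unfolding dist using that by (intro INF_greatest) auto
  have le: "graph_dist G u v \<le> ereal (real (length p))" if "awalk u p v" for p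
    unfolding dist using that by (intro INF_lower) auto
  show ?thesis
  proof
    assume eq: "graph_dist G u v = ereal (real n)"
    have low: "n \<le> length p" if "awalk u p v" for p
      using le[OF that] eq by simp
    \<comment> \<open>Otherwise the distance would be at least \<open>n + 1\<close>; this also
      excludes the absence of walks.\<close>
    have "\<not> (\<forall>p. awalk u p v \<longrightarrow> Suc n \<le> length p)"
      using ge[of "Suc n"] eq by auto
    then obtain p where "awalk u p v" "length p \<le> n"
      by auto
    with low show "(\<exists>p. awalk u p v \<and> length p = n) \<and> (\<forall>p. awalk u p v \<longrightarrow> n \<le> length p)"
      using le_antisym by blast
  next
    assume "(\<exists>p. awalk u p v \<and> length p = n) \<and> (\<forall>p. awalk u p v \<longrightarrow> n \<le> length p)"
    then show "graph_dist G u v = ereal (real n)"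
      using ge le by (metis order_antisym)
  qed
qed

text \<open>Removes distances from the rest of the argument: for distinct vertices, distance 1 or 2
  just means a walk of length 1 or 2.\<close>

lemma (in pair_wf_digraph) parcs_graph_square:
  "parcs (graph_square G) =
     {(u, v). u \<noteq> v \<and> ((u, v) \<in> parcs G \<or> (\<exists>w. (u, w) \<in> parcs G \<and> (w, v) \<in> parcs G))}"
proof -
  have walk1: "(\<exists>p. awalk u p v \<and> length p = 1) \<longleftrightarrow> (u, v) \<in> parcs G" for u v
  proof
    assume "\<exists>p. awalk u p v \<and> length p = 1"
    then obtain e where "awalk u [e] v" by (auto simp: length_Suc_conv)
    then show "(u, v) \<in> parcs G" by (cases e) (auto simp: awalk_simps)
  next
    assume "(u, v) \<in> parcs G"
    then have "awalk u [(u, v)] v"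
      using arc_fst_in_verts arc_snd_in_verts by (force simp: awalk_simps)
    then show "\<exists>p. awalk u p v \<and> length p = 1" by (metis One_nat_def length_Cons list.size(3))
  qed
  have walk2: "(\<exists>p. awalk u p v \<and> length p = 2) \<longleftrightarrow> (\<exists>w. (u, w) \<in> parcs G \<and> (w, v) \<in> parcs G)" for u v
  proof
    assume "\<exists>p. awalk u p v \<and> length p = 2"
    then obtain e f where "awalk u [e, f] v" by (auto simp: numeral_2_eq_2 length_Suc_conv)
    then show "\<exists>w. (u, w) \<in> parcs G \<and> (w, v) \<in> parcs G"
      by (cases e; cases f) (auto simp: awalk_simps)
  next
    assume "\<exists>w. (u, w) \<in> parcs G \<and> (w, v) \<in> parcs G"
    then obtain w where "(u, w) \<in> parcs G" "(w, v) \<in> parcs G" by blast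
    then have "awalk u [(u, w), (w, v)] v"
      using arc_fst_in_verts arc_snd_in_verts by (force simp: awalk_simps)
    then show "\<exists>p. awalk u p v \<and> length p = 2" by force
  qed
  have dist1: "graph_dist G u v = 1 \<longleftrightarrow> (u, v) \<in> parcs G" if "u \<noteq> v" for u v
  proof -
    have "1 \<le> length p" if "awalk u p v" for p
      using that \<open>u \<noteq> v\<close> by (cases p) (auto simp: awalk_simps)
    then show ?thesis using graph_dist_eq_iff[of u v 1] walk1[of u v] by auto
  qed
  have dist2: "graph_dist G u v = 2 \<longleftrightarrow>
      (u, v) \<notin> parcs G \<and> (\<exists>w. (u, w) \<in> parcs G \<and> (w, v) \<in> parcs G)" if "u \<noteq> v" for u v
  proof -
    have "2 \<le> length p \<longleftrightarrow> length p \<noteq> 1" if "awalk u p v" for p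
      using that \<open>u \<noteq> v\<close> by (cases p) (auto simp: awalk_simps Suc_le_eq)
    then have "(\<forall>p. awalk u p v \<longrightarrow> 2 \<le> length p) \<longleftrightarrow> (u, v) \<notin> parcs G"
      using walk1[of u v] by blast
    then show ?thesis using graph_dist_eq_iff[of u v 2] walk2[of u v] by auto
  qed
  show ?thesis
    using dist1 dist2 arc_fst_in_verts arc_snd_in_verts
    unfolding graph_square_def by fastforce
qed

section \<open>Biconnectedness from a Hamiltonian cycle\<close>

text \<open>Connectedness is strong connectedness of the symmetric closure, whose reachability
  relation is symmetric, so any two vertices can be joined through the hub \<open>h\<close>.\<close>

lemma connectedI_hub:
  assumes "wf_digraph H" and "h \<in> verts H"
    and reach: "\<And>u. u \<in> verts H \<Longrightarrow> (u, h) \<in> (arcs_ends H \<union> (arcs_ends H)\<inverse>)\<^sup>*"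
  shows "Digraph_Component.connected H"
proof -
  interpret H: wf_digraph H by fact
  let ?S = "with_proj (mk_symmetric H)"
  have ends: "arcs_ends ?S = arcs_ends H \<union> (arcs_ends H)\<inverse>"
    by (auto simp: mk_symmetric_def arcs_ends_def arc_to_ends_def)
  have verts: "verts ?S = verts H" by (simp add: mk_symmetric_def)
  have "wf_digraph ?S"
    using H.wellformed by unfold_locales (auto simp: mk_symmetric_def)
  then interpret S: wf_digraph ?S .
  have "sym ((arcs_ends H \<union> (arcs_ends H)\<inverse>)\<^sup>*)"
    by (intro sym_rtrancl) (auto intro: symI)
  then have "(u, v) \<in> (arcs_ends H \<union> (arcs_ends H)\<inverse>)\<^sup>*" if "u \<in> verts H" "v \<in> verts H" for u v
    using reach[OF that(1)] reach[OF that(2)] by (meson rtrancl_trans symD)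
  then show ?thesis
    unfolding Digraph_Component.connected_def strongly_connected_def S.reachable_conv ends
    using assms(2) verts by auto
qed

lemma rtrancl_upwards:
  fixes i j :: nat
  assumes "i \<le> j" and "\<And>k. i \<le> k \<Longrightarrow> k < j \<Longrightarrow> (k, Suc k) \<in> R"
  shows "(i, j) \<in> R\<^sup>*"
  using assms by (induction j rule: dec_induct) (auto intro: rtrancl_into_rtrancl)

text \<open>Deleting a vertex from a cycle leaves a path; extra edges do no harm.\<close>

lemma biconnected_hamiltonian_cycle:
  assumes "pair_graph G" and verts: "pverts G = {..<n}" and n: "n \<ge> 3"
    and step: "\<And>i. Suc i < n \<Longrightarrow> (i, Suc i) \<in> parcs G"
    and close: "(0, n - 1) \<in> parcs G"
  shows "biconnected G"
proof -
  interpret G: pair_graph G by fact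
  have "Digraph_Component.connected (with_proj G)"
  proof (rule connectedI_hub)
    show "n - 1 \<in> verts (with_proj G)" using verts n by simp
    fix u assume "u \<in> verts (with_proj G)"
    then show "(u, n - 1) \<in> (arcs_ends (with_proj G) \<union> (arcs_ends (with_proj G))\<inverse>)\<^sup>*"
      using verts step by (intro rtrancl_upwards) auto
  qed unfold_locales
  moreover have "Digraph_Component.connected (pre_digraph.del_vert (with_proj G) v)"
    if "v \<in> pverts G" for v
  proof -
    let ?H = "pre_digraph.del_vert (with_proj G) v"
    let ?R = "arcs_ends ?H \<union> (arcs_ends ?H)\<inverse>"
    have "v < n" using that verts by simp
    have ends: "arcs_ends ?H = {(a, b). (a, b) \<in> parcs G \<and> a \<noteq> v \<and> b \<noteq> v}"
      by (auto simp: arcs_ends_def arc_to_ends_def pre_digraph.del_vert_def)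
    have vertsH: "verts ?H = {..<n} - {v}" by (simp add: pre_digraph.del_vert_def verts)
    have wf: "wf_digraph ?H" by (rule G.wf_digraph_del_vert)
    have up: "(i, j) \<in> ?R\<^sup>*" if "i \<le> j" "j < n" "v < i \<or> j < v" for i j
      using that step by (intro rtrancl_upwards) (auto simp: ends)
    have "sym (?R\<^sup>*)" by (intro sym_rtrancl) (auto intro: symI)
    then have down: "(j, i) \<in> ?R\<^sup>*" if "i \<le> j" "j < n" "v < i \<or> j < v" for i j
      using up[OF that] by (meson symD)
    show ?thesis
    \<comment> \<open>The hub must survive the deletion: \<open>n - 1\<close> if
      \<open>v = 0\<close>, and \<open>0\<close> otherwise. In the latter case vertices below
      \<open>v\<close> descend to \<open>0\<close>, while those above climb to \<open>n - 1\<close>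
      and take the closing edge.\<close>
    proof (cases "v = 0")
      case True
      show ?thesis
      proof (rule connectedI_hub[OF wf])
        show "n - 1 \<in> verts ?H" unfolding vertsH using True n by simp
        fix u assume "u \<in> verts ?H"
        then have "u < n" "0 < u" using True unfolding vertsH by auto
        then show "(u, n - 1) \<in> ?R\<^sup>*" using True by (intro up) linarith+
      qed
    next
      case False
      have "(u, 0) \<in> ?R\<^sup>*" if u: "u < n" "u \<noteq> v" for u
      proof (cases "u < v")
        case True
        then show ?thesis using down[of 0 u] u by simp
      next
        case above: False
        have "(n - 1, 0) \<in> ?R" using close False above u by (auto simp: ends)
        moreover have "(u, n - 1) \<in> ?R\<^sup>*" using above u by (intro up) linarith+
        ultimately show ?thesis by (rule rtrancl_into_rtrancl[rotated])
      qed
      then have "(u, 0) \<in> ?R\<^sup>*" if "u \<in> verts ?H" for u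
        using that unfolding vertsH by simp
      moreover have "0 \<in> verts ?H" unfolding vertsH using False n by simp
      ultimately show ?thesis by (intro connectedI_hub[OF wf])
    qed
  qed
  ultimately show ?thesis
    unfolding biconnected_def using verts n by simp
qed

section \<open>Chords of a parabola\<close>

definition parabola_point :: "nat \<Rightarrow> complex" where
  "parabola_point k = Complex (real k) ((real k)\<^sup>2)"

text \<open>The secant through the points over \<open>a\<close> and \<open>b\<close> has slope
  \<open>a + b\<close> and intercept \<open>- a * b\<close>, so a chord is described by linear
  conditions in the abscissa.\<close>

lemma parabola_chord_iff:
  assumes "a < b"
  shows "z \<in> closed_segment (parabola_point a) (parabola_point b) \<longleftrightarrow>
     real a \<le> Re z \<and> Re z \<le> real b \<and> Im z = (real a + real b) * Re z - real a * real b"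
proof
  assume "z \<in> closed_segment (parabola_point a) (parabola_point b)"
  then obtain t where t: "0 \<le> t" "t \<le> 1"
    "z = (1 - t) *\<^sub>R parabola_point a + t *\<^sub>R parabola_point b"
    by (auto simp: in_segment)
  have re: "Re z = real a + t * (real b - real a)"
    unfolding t(3) by (simp add: parabola_point_def algebra_simps)
  moreover have "Im z = (real a + real b) * Re z - real a * real b"
    unfolding re unfolding t(3) by (simp add: parabola_point_def algebra_simps power2_eq_square)
  moreover have "0 \<le> t * (real b - real a)" "t * (real b - real a) \<le> 1 * (real b - real a)"
    using t assms by (auto intro: mult_right_mono)
  ultimately show "real a \<le> Re z \<and> Re z \<le> real b \<and> Im z = (real a + real b) * Re z - real a * real b"
    by auto
next
  assume z: "real a \<le> Re z \<and> Re z \<le> real b \<and> Im z = (real a + real b) * Re z - real a * real b"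
  define t where "t = (Re z - real a) / (real b - real a)"
  have t: "0 \<le> t" "t \<le> 1" "t * (real b - real a) = Re z - real a"
    using z assms by (auto simp: t_def divide_simps)
  have "Re z = real a + t * (real b - real a)" using t by simp
  moreover have "Im z = (real a)\<^sup>2 + t * ((real b)\<^sup>2 - (real a)\<^sup>2)"
  proof -
    have "t * ((real b)\<^sup>2 - (real a)\<^sup>2) = (t * (real b - real a)) * (real a + real b)"
      by (simp add: algebra_simps power2_eq_square)
    then show ?thesis using z unfolding t(3) by (simp add: algebra_simps power2_eq_square)
  qed
  ultimately have "z = (1 - t) *\<^sub>R parabola_point a + t *\<^sub>R parabola_point b"
    by (intro complex_eqI) (auto simp: parabola_point_def algebra_simps)
  then show "z \<in> closed_segment (parabola_point a) (parabola_point b)"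
    using t by (auto simp: in_segment)
qed

text \<open>The equation of the secant at a point of the parabola factors as
  \<open>(k - a) * (k - b) = 0\<close>.\<close>

lemma parabola_chord_Int_parabola:
  assumes "a < b" and "parabola_point k \<in> closed_segment (parabola_point a) (parabola_point b)"
  shows "k = a \<or> k = b"
proof -
  have "(real k - real a) * (real k - real b) = 0"
    using assms(2) unfolding parabola_chord_iff[OF assms(1)]
    by (simp add: parabola_point_def algebra_simps power2_eq_square)
  then show ?thesis by simp
qed

lemma parabola_chords_Int_le:
  assumes "a < b" "c < d" "a \<le> c" and uncrossed: "\<not> (a < c \<and> c < b \<and> b < d)" and "(a, b) \<noteq> (c, d)"
    and zab: "z \<in> closed_segment (parabola_point a) (parabola_point b)"
    and zcd: "z \<in> closed_segment (parabola_point c) (parabola_point d)"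
  shows "z \<in> parabola_point ` ({a, b} \<inter> {c, d})"
proof -
  note ab = zab[unfolded parabola_chord_iff[OF assms(1)]]
  note cd = zcd[unfolded parabola_chord_iff[OF assms(2)]]
  have endpoint: "z = parabola_point k" if "k = a \<or> k = b" "Re z = real k" for k
    using that ab by (intro complex_eqI) (auto simp: parabola_point_def algebra_simps power2_eq_square)
  consider (right) "b \<le> c" | (left) "a = c" | (nested) "a < c" "d \<le> b"
    using assms by linarith
  then show ?thesis
  proof cases
    case right
    then have "b = c" "Re z = real b" using ab cd by auto
    then show ?thesis using endpoint by auto
  next
    case left
    then have "b \<noteq> d" using assms by auto
    \<comment> \<open>Both lines pass through the point over \<open>a\<close>, with different slopes
      \<open>a + b\<close> and \<open>a + d\<close>.\<close>
    have "(real d - real b) * (Re z - real a) = 0"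
      using ab cd left by (simp add: algebra_simps)
    then show ?thesis using \<open>b \<noteq> d\<close> left endpoint by auto
  next
    case nested
    \<comment> \<open>Over \<open>[c, d]\<close> the difference of the two chords interpolates linearly between
      \<open>(c - a) (b - c) > 0\<close> and \<open>(d - a) (b - d) \<ge> 0\<close>.\<close>
    have "(real d - real c) * ((real a + real b) * Re z - real a * real b
           - ((real c + real d) * Re z - real c * real d))
       = (real d - Re z) * ((real c - real a) * (real b - real c))
         + (Re z - real c) * ((real d - real a) * (real b - real d))"
      by algebra
    then have sum0: "(real d - Re z) * ((real c - real a) * (real b - real c))
         + (Re z - real c) * ((real d - real a) * (real b - real d)) = 0"
      using ab cd by simp
    have "0 \<le> (real d - Re z) * ((real c - real a) * (real b - real c))"
      "0 \<le> (Re z - real c) * ((real d - real a) * (real b - real d))"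
      using ab cd nested assms(1,2) by (auto intro!: mult_nonneg_nonneg)
    with sum0 have "(real d - Re z) * ((real c - real a) * (real b - real c)) = 0"
      "(Re z - real c) * ((real d - real a) * (real b - real d)) = 0"
      by linarith+
    \<comment> \<open>Here \<open>c < d \<le> b\<close> makes \<open>(c - a) * (b - c)\<close>
      positive, so \<open>Re z = d\<close>; then \<open>d - c\<close> and \<open>d - a\<close> are
      positive, which leaves \<open>b = d\<close>.\<close>
    then have "Re z = real d" "d = b" using nested assms(1,2) by auto
    then show ?thesis using endpoint by auto
  qed
qed

lemma parabola_chords_Int:
  assumes "a < b" "c < d" "\<not> (a < c \<and> c < b \<and> b < d)" "\<not> (c < a \<and> a < d \<and> d < b)" "(a, b) \<noteq> (c, d)"
  shows "closed_segment (parabola_point a) (parabola_point b) \<inter>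
         closed_segment (parabola_point c) (parabola_point d) = parabola_point ` ({a, b} \<inter> {c, d})"
proof (intro equalityI subsetI)
  fix z assume z: "z \<in> closed_segment (parabola_point a) (parabola_point b) \<inter>
         closed_segment (parabola_point c) (parabola_point d)"
  show "z \<in> parabola_point ` ({a, b} \<inter> {c, d})"
  proof (cases "a \<le> c")
    case True
    then show ?thesis using z assms parabola_chords_Int_le[of a b c d z] by auto
  next
    case False
    then have "z \<in> parabola_point ` ({c, d} \<inter> {a, b})"
      using z assms by (intro parabola_chords_Int_le) auto
    then show ?thesis by (simp add: Int_commute)
  qed
qed auto

lemma convex_parabola_epigraph: "convex {z. (Re z)\<^sup>2 \<le> Im z}"
proof (rule convexI)
  fix x y :: complex and u v :: real
  assume xy: "x \<in> {z. (Re z)\<^sup>2 \<le> Im z}" "y \<in> {z. (Re z)\<^sup>2 \<le> Im z}" and uv: "0 \<le> u" "0 \<le> v" "u + v = 1"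
  \<comment> \<open>Convexity of squaring, with the defect written out using
    \<open>u + v = 1\<close>.\<close>
  have "(u * Re x + v * Re y)\<^sup>2 = u * (Re x)\<^sup>2 + v * (Re y)\<^sup>2 - u * v * (Re x - Re y)\<^sup>2"
  proof -
    have "v = 1 - u" using uv by simp
    then show ?thesis by algebra
  qed
  also have "\<dots> \<le> u * (Re x)\<^sup>2 + v * (Re y)\<^sup>2"
    using uv by simp
  also have "\<dots> \<le> u * Im x + v * Im y"
    using xy uv by (intro add_mono mult_left_mono) auto
  finally show "u *\<^sub>R x + v *\<^sub>R y \<in> {z. (Re z)\<^sup>2 \<le> Im z}" by simp
qed

section \<open>Outerplanar drawings from non-crossing chords\<close>

text \<open>Points of a parabola are in convex position, so straight edges meet improperly only if
  their ends interleave. The drawing lies in the convex epigraph, and everything strictly below the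
  parabola is outside it.\<close>

lemma outerplanar_noncrossing:
  fixes G :: "nat pair_pre_digraph"
  assumes "pair_graph G"
    and noncrossing: "\<And>a b c d. (a, b) \<in> parcs G \<Longrightarrow> (c, d) \<in> parcs G \<Longrightarrow> \<not> (a < c \<and> c < b \<and> b < d)"
  shows "outerplanar G"
proof -
  interpret G: pair_graph G by fact
  let ?p = parabola_point
  \<comment> \<open>Edges are unordered sets; \<open>Min\<close> and \<open>Max\<close> fix an
    orientation for each curve.\<close>
  define \<gamma> where "\<gamma> e = linepath (?p (Min e)) (?p (Max e))" for e
  let ?S = "drawing_image G ?p \<gamma>"
  let ?T = "{z. (Re z)\<^sup>2 \<le> Im z}"
  have inj: "inj ?p" by (auto simp: inj_def parabola_point_def)
  have edge: "\<exists>a b. a < b \<and> e = {a, b} \<and> (a, b) \<in> parcs G" if e: "e \<in> undirected_edges G" for e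
  proof -
    obtain u v where uv: "(u, v) \<in> parcs G" "e = {u, v}"
      using e unfolding undirected_edges_def by blast
    then have "(v, u) \<in> parcs G" "u \<noteq> v"
      using G.pair_sym_arcs G.pair_no_loops[OF uv(1)] by (auto simp: symmetric_def dest: symD)
    then show ?thesis using uv by (cases u v rule: linorder_cases) auto
  qed
  have image: "path_image (\<gamma> {a, b}) = closed_segment (?p a) (?p b)" if "a < b" for a b
    using that by (simp add: \<gamma>_def min_def max_def)
  have "plane_drawing G ?p \<gamma>"
    unfolding plane_drawing_def
  proof (intro conjI ballI impI)
    show "inj_on ?p (pverts G)" using inj by (rule inj_on_subset) simp
  next
    fix e assume "e \<in> undirected_edges G"
    then obtain a b where ab: "a < b" "e = {a, b}" "(a, b) \<in> parcs G" using edge by blast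
    show "Path_Connected.arc (\<gamma> e)"
      using ab inj by (simp add: \<gamma>_def min_def max_def arc_linepath inj_eq)
    show "{pathstart (\<gamma> e), pathfinish (\<gamma> e)} = ?p ` e"
      using ab by (simp add: \<gamma>_def min_def max_def)
    have "a \<in> pverts G" "b \<in> pverts G"
      using ab(3) G.arc_fst_in_verts G.arc_snd_in_verts by force+
    then show "path_image (\<gamma> e) \<inter> ?p ` pverts G = ?p ` e"
      using ab parabola_chord_Int_parabola[OF ab(1)] by (auto simp: image)
  next
    fix e f assume "e \<in> undirected_edges G" "f \<in> undirected_edges G" "e \<noteq> f"
    moreover from this obtain a b c d where "a < b" "e = {a, b}" "(a, b) \<in> parcs G"
      "c < d" "f = {c, d}" "(c, d) \<in> parcs G"
      using edge by metis
    ultimately show "path_image (\<gamma> e) \<inter> path_image (\<gamma> f) = ?p ` (e \<inter> f)"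
      using noncrossing[of a b c d] noncrossing[of c d a b] parabola_chords_Int[of a b c d]
      by (auto simp: image)
  qed
  moreover have "?p ` pverts G \<subseteq> frontier (outside ?S)"
  proof
    fix z assume "z \<in> ?p ` pverts G"
    then obtain k where k: "k \<in> pverts G" "z = ?p k" by blast
    have vertex: "?p j \<in> ?T" for j by (simp add: parabola_point_def)
    have "path_image (\<gamma> e) \<subseteq> ?T" for e
      unfolding \<gamma>_def path_image_linepath
      using vertex by (intro closed_segment_subset convex_parabola_epigraph)
    then have "?S \<subseteq> ?T" using vertex unfolding drawing_image_def by blast
    then have outside: "- ?T \<subseteq> outside ?S"
      by (intro outside_subset_convex convex_parabola_epigraph)
    \<comment> \<open>The vertex is approached vertically from below, through points outside the
      epigraph.\<close>
    have "(\<lambda>m. z - Complex 0 (inverse (real (Suc m)))) \<longlonglongrightarrow> z - Complex 0 0"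
      by (intro tendsto_intros tendsto_Complex LIMSEQ_inverse_real_of_nat)
    then have "(\<lambda>m. z - Complex 0 (inverse (real (Suc m)))) \<longlonglongrightarrow> z"
      by (simp flip: zero_complex.code)
    moreover have "z - Complex 0 (inverse (real (Suc m))) \<in> outside ?S" for m
      using outside k(2) by (force simp: parabola_point_def)
    ultimately have "z \<in> closure (outside ?S)"
      unfolding closure_sequential
      by (intro exI[of _ "\<lambda>m. z - Complex 0 (inverse (real (Suc m)))"]) simp
    moreover have "z \<in> ?S" using k by (auto simp: drawing_image_def)
    then have "z \<notin> interior (outside ?S)"
      using outside_no_overlap[of ?S] interior_subset by blast
    ultimately show "z \<in> frontier (outside ?S)" by (simp add: frontier_def)
  qed
  ultimately show ?thesis unfolding outerplanar_def by blast
qed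

section \<open>Bounds on colours and an isomorphism invariant\<close>

lemma proper_colouring_card_le:
  assumes "proper_colouring G k c" and "A \<subseteq> pverts G" and "inj_on c A"
  shows "card A \<le> k"
proof -
  have "c ` A \<subseteq> {..<k}" using assms(1,2) by (auto simp: proper_colouring_def)
  then show ?thesis using card_inj_on_le[OF assms(3), of "{..<k}"] by simp
qed

lemma digraph_iso_card_verts:
  assumes "digraph_iso G H"
  shows "card (verts H) = card (verts G)"
  using assms
  by (auto simp: digraph_iso_def pre_digraph.digraph_isomorphism_def card_image)

section \<open>The witness graphs\<close>

text \<open>For the orders used, each edge occurs once, smaller end first; \<open>witness\<close>
  adds the reversed arcs.\<close>

definition witness_edges :: "nat \<Rightarrow> (nat \<times> nat) set" where
  "witness_edges n = {(a, b). b < n \<and> (b = Suc a \<or> a = 0 \<and> b = n - 1 \<or>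
     (a, b) \<in> {(0, 9), (1, 3), (1, 7), (3, 5), (3, 7), (7, 9)})}"

definition witness :: "nat \<Rightarrow> nat pair_pre_digraph" where
  "witness n = \<lparr> pverts = {..<n}, parcs = witness_edges n \<union> (witness_edges n)\<inverse> \<rparr>"

text \<open>An adjacency table: only vertices below 10 lie on chords, the others have just their two
  cycle neighbours. Degrees and colourings are then checked row by row.\<close>

definition witness_nbrs :: "nat \<Rightarrow> nat \<Rightarrow> nat set" where
  "witness_nbrs n w =
     (if w < 10
      then [{1, 9, n - 1}, {0, 2, 3, 7}, {1, 3}, {1, 2, 4, 5, 7}, {3, 5}, {3, 4, 6}, {5, 7},
            {1, 3, 6, 8, 9}, {7, 9}, {0, 7, 8, 10}] ! w
      else {w - 1, if Suc w = n then 0 else Suc w})"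

text \<open>The tail starts with colour 2 at vertex 10 and has period three; for
  \<open>n = 13 + 3 * k\<close> it ends with colour 1 at \<open>n - 1\<close>, compatible with the
  colours 6, 0 and 5 of the vertices 0, 1 and 9.\<close>

definition witness_colour :: "nat \<Rightarrow> nat" where
  "witness_colour w = (if w < 10 then [6, 0, 3, 2, 4, 5, 3, 1, 4, 5] ! w else Suc w mod 3)"

lemma pverts_witness [simp]: "pverts (witness n) = {..<n}"
  by (simp add: witness_def)

lemma less_10_cases:
  assumes "(w :: nat) < 10"
  shows "w \<in> {0, 1, 2, 3, 4, 5, 6, 7, 8, 9}"
  using assms by auto

lemma witness_arc_iff:
  assumes "n \<ge> 13"
  shows "(w, v) \<in> parcs (witness n) \<longleftrightarrow> w < n \<and> v \<in> witness_nbrs n w"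
proof (cases "w < 10")
  case True
  then show ?thesis
    using assms less_10_cases[OF True]
    by (elim insertE emptyE; simp add: witness_def witness_edges_def witness_nbrs_def; arith)
next
  case False
  then show ?thesis
    using assms by (auto simp: witness_def witness_edges_def witness_nbrs_def)
qed

lemma pair_graph_witness: "pair_graph (witness n)" if "n \<ge> 13"
proof
  show "finite (parcs (witness n))"
    by (rule finite_subset[of _ "{..<n} \<times> {..<n}"]) (auto simp: witness_def witness_edges_def)
  show "symmetric (with_proj (witness n))"
    by (auto simp: witness_def symmetric_def intro!: symI)
qed (use that in \<open>auto simp: witness_def witness_edges_def\<close>)

lemma biconnected_witness: "biconnected (witness n)" if "n \<ge> 13"
  using that by (intro biconnected_hamiltonian_cycle[where n = n] pair_graph_witness)
    (auto simp: witness_def witness_edges_def)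

lemma outerplanar_witness: "outerplanar (witness n)" if "n \<ge> 13"
proof (rule outerplanar_noncrossing[OF pair_graph_witness[OF that]])
  fix a b c d assume "(a, b) \<in> parcs (witness n)" "(c, d) \<in> parcs (witness n)"
  show "\<not> (a < c \<and> c < b \<and> b < d)"
  proof
    assume less: "a < c \<and> c < b \<and> b < d"
    \<comment> \<open>The inequalities give \<open>a < b\<close> and \<open>c < d\<close>, so
      neither arc is a reversed one.\<close>
    then have "(a, b) \<in> witness_edges n" "(c, d) \<in> witness_edges n"
      using \<open>(a, b) \<in> _\<close> \<open>(c, d) \<in> _\<close> by (auto simp: witness_def witness_edges_def)
    then show False using less by (auto simp: witness_edges_def)
  qed
qed

lemma max_degree_witness: "max_degree (witness n) = 5" if n: "n \<ge> 13"
proof -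
  have deg: "out_degree (with_proj (witness n)) w = card (witness_nbrs n w)" if "w < n" for w
  proof -
    have "out_arcs (with_proj (witness n)) w = Pair w ` witness_nbrs n w"
      using witness_arc_iff[OF n] that by (auto simp: out_arcs_def)
    then show ?thesis by (simp add: out_degree_def card_image inj_on_def)
  qed
  have "card (witness_nbrs n w) \<le> 5" for w
  proof (cases "w < 10")
    case True
    then show ?thesis using less_10_cases[OF True]
      by (elim insertE emptyE) (simp_all add: witness_nbrs_def card_insert_if)
  next
    case False
    then show ?thesis by (simp add: witness_nbrs_def card_insert_if)
  qed
  \<comment> \<open>The bound is attained at vertex 3, with neighbours 1, 2, 4, 5 and 7.\<close>
  moreover have "card (witness_nbrs n 3) = 5" by (simp add: witness_nbrs_def)
  ultimately show ?thesis
    unfolding max_degree_def using n deg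
    by (intro Max_eqI) (auto intro!: image_eqI[of _ _ 3])
qed

section \<open>The chromatic number of the squares\<close>

text \<open>Two vertices adjacent in the square share a closed neighbourhood, so injectivity of the
  colouring on every closed neighbourhood suffices.\<close>

lemma witness_colouring:
  "proper_colouring (graph_square (witness (13 + 3 * k))) 7 witness_colour"
proof -
  let ?n = "13 + 3 * k"
  have n: "?n \<ge> 13" by simp
  interpret G: pair_graph "witness ?n" using n by (rule pair_graph_witness)
  have last: "Suc (12 + 3 * k) mod 3 = 1" by presburger
  have inj: "inj_on witness_colour (insert w (witness_nbrs ?n w))" if w: "w < ?n" for w
  proof (cases "w < 10")
    case True
    then show ?thesis
      using less_10_cases[OF True] last
      by (elim insertE emptyE) (simp_all add: witness_nbrs_def witness_colour_def)
  next
    case False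
    consider "w = 10" | "w = 12 + 3 * k" | "10 < w" "w < 12 + 3 * k"
      using w False by linarith
    then show ?thesis
    proof cases
      case 3
      \<comment> \<open>The closed neighbourhood is \<open>m\<close>, \<open>m + 1\<close>,
        \<open>m + 2\<close>, all in the tail, with three consecutive residues modulo 3.\<close>
      then obtain m where "w = Suc m" "10 \<le> m" by (cases w) auto
      moreover have "Suc m mod 3 \<noteq> Suc (Suc m) mod 3" "Suc (Suc m) mod 3 \<noteq> Suc (Suc (Suc m)) mod 3"
         "Suc m mod 3 \<noteq> Suc (Suc (Suc m)) mod 3"
        by presburger+
      ultimately show ?thesis using 3 by (simp add: witness_nbrs_def witness_colour_def)
    qed (use last in \<open>auto simp: witness_nbrs_def witness_colour_def\<close>)
  qed
  have "witness_colour w < 7" for w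
  proof (cases "w < 10")
    case True
    then show ?thesis using less_10_cases[OF True]
      by (elim insertE emptyE) (simp_all add: witness_colour_def)
  next
    case False
    then show ?thesis by (simp add: witness_colour_def less_trans[OF mod_less_divisor[of 3]])
  qed
  moreover have "witness_colour u \<noteq> witness_colour v"
    if uv: "(u, v) \<in> parcs (graph_square (witness ?n))" for u v
  proof -
    have "u \<noteq> v" using uv by (simp add: G.parcs_graph_square)
    obtain w where "w < ?n" "u \<in> insert w (witness_nbrs ?n w)" "v \<in> insert w (witness_nbrs ?n w)"
    proof (cases "(u, v) \<in> parcs (witness ?n)")
      case True
      then show ?thesis using that[of u] by (auto simp: witness_arc_iff[OF n])
    next
      case False
      then obtain w where "(u, w) \<in> parcs (witness ?n)" "(w, v) \<in> parcs (witness ?n)"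
        using uv by (auto simp: G.parcs_graph_square)
      moreover from this have "(w, u) \<in> parcs (witness ?n)" by (auto simp: witness_def)
      ultimately show ?thesis using that[of w] by (auto simp: witness_arc_iff[OF n])
    qed
    then show ?thesis using inj_onD[OF inj] \<open>u \<noteq> v\<close> by blast
  qed
  ultimately show ?thesis by (auto simp: proper_colouring_def)
qed

lemma witness_colouring_ge:
  assumes n: "n \<ge> 13" and c: "proper_colouring (graph_square (witness n)) k c"
  shows "k \<ge> 7"
proof (rule ccontr)
  assume "\<not> k \<ge> 7"
  interpret G: pair_graph "witness n" using n by (rule pair_graph_witness)
  have arcs_sym: "(a, b) \<in> parcs (witness n)" if "(b, a) \<in> parcs (witness n)" for a b
    using that by (auto simp: witness_def)
  have adj: "c u \<noteq> c v"
    if "w < n" "u \<noteq> v" "u \<in> insert w (witness_nbrs n w)" "v \<in> insert w (witness_nbrs n w)"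
    for u v w
  proof -
    have "u = w \<or> (u, w) \<in> parcs (witness n)" "v = w \<or> (w, v) \<in> parcs (witness n)"
      using that witness_arc_iff[OF n] arcs_sym by blast+
    then have "(u, v) \<in> parcs (graph_square (witness n))"
      using \<open>u \<noteq> v\<close> unfolding G.parcs_graph_square by auto
    then show ?thesis using c by (auto simp: proper_colouring_def)
  qed
  \<comment> \<open>Pigeonhole: at most six colours cannot separate seven vertices.\<close>
  have clash: "\<exists>u\<in>A. \<exists>v\<in>A. u < v \<and> c u = c v" if "A \<subseteq> {..<n}" "card A = 7" for A
  proof (rule ccontr)
    assume "\<not> ?thesis"
    then have "inj_on c A"
      by (metis inj_onI linorder_neqE_nat)
    then have "card A \<le> k"
      using that by (intro proper_colouring_card_le[OF c]) (auto simp: graph_square_def)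
    then show False using that \<open>\<not> k \<ge> 7\<close> by simp
  qed
  note near = adj[of 0] adj[of 1] adj[of 2] adj[of 3] adj[of 4] adj[of 5] adj[of 6] adj[of 7]
    adj[of 8] adj[of 9]
  \<comment> \<open>All other pairs in this set are adjacent in the square.\<close>
  have "c 0 = c 6"
    using clash[of "{0, 1, 3, 6, 7, 8, 9}"] n near by (simp add: witness_nbrs_def)
  \<comment> \<open>Both are neighbours of 1. In the seven-set used next, only 2 and 6 could agree,
    which would give \<open>c 2 = c 0\<close>.\<close>
  moreover have "c 0 \<noteq> c 2"
    using n near(2) by (simp add: witness_nbrs_def)
  ultimately show False
    using clash[of "{1, 2, 3, 4, 5, 6, 7}"] n near by (simp add: witness_nbrs_def)
qed

lemma chromatic_number_witness_square:
  "chromatic_number (graph_square (witness (13 + 3 * k))) = 7"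
  unfolding chromatic_number_def
  by (intro Least_equality) (auto intro: witness_colouring intro!: witness_colouring_ge[of "13 + 3 * k"])

section \<open>The infinite family\<close>

theorem theorem6p1:
  shows "\<exists>\<G> :: nat pair_pre_digraph set.
           infinite \<G> \<and>
           pairwise (\<lambda>G H. \<not> digraph_iso (with_proj G) (with_proj H)) \<G> \<and>
           (\<forall>G\<in>\<G>. pair_graph G \<and> biconnected G \<and> outerplanar G \<and>
                    max_degree G = 5 \<and> chromatic_number (graph_square G) = 7)"
proof (intro exI conjI)
  let ?\<G> = "range (\<lambda>k. witness (13 + 3 * k))"
  \<comment> \<open>The order recovers the parameter, which gives both infinitude and pairwise
    non-isomorphism.\<close>
  have order: "card (pverts (witness n)) = n" for n by simp
  have "inj (\<lambda>k. witness (13 + 3 * k))"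
    by (rule injI) (metis order add_left_cancel mult_left_cancel zero_neq_numeral)
  then show "infinite ?\<G>" by (rule range_inj_infinite)
  show "pairwise (\<lambda>G H. \<not> digraph_iso (with_proj G) (with_proj H)) ?\<G>"
    using digraph_iso_card_verts by (force simp: pairwise_def)
  show "\<forall>G\<in>?\<G>. pair_graph G \<and> biconnected G \<and> outerplanar G \<and>
                    max_degree G = 5 \<and> chromatic_number (graph_square G) = 7"
    using pair_graph_witness biconnected_witness outerplanar_witness max_degree_witness
      chromatic_number_witness_square by auto
qed

end
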